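(* Let $A\subseteq \mathbb{R}$ be countable. Then there is a function $f:A\to\{0,1\}$ which is uniformly antisymmetric on $A$, i.e. for every $x\in A$ there is $d(x)>0$ such that for every $h$ with $0<h<d(x)$ and $x-h,\,x+h\in A$ we have $|f(x+h)-f(x-h)|\geq d(x)$. *)

theory Defs
  imports Complex_Main "HOL-Library.Countable_Set" "HOL-Library.FuncSet"
begin

definition uniformly_antisymmetric_on :: "real set \<Rightarrow> (real \<Rightarrow> real) \<Rightarrow> bool" where
  "uniformly_antisymmetric_on A f \<longleftrightarrow>
     (\<forall>x\<in>A. \<exists>d>0. \<forall>h. 0 < h \<and> h < d \<and> x - h \<in> A \<and> x + h \<in> A \<longrightarrow>
        \<bar>f (x + h) - f (x - h)\<bar> \<ge> d)"

end

theory Submission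
  imports Defs "HOL-Analysis.Continuum_Not_Denumerable"
begin

text \<open>
  Join \<open>x - h\<close> and \<open>x + h\<close> whenever \<open>x \<in> A\<close> and \<open>0 < h < d x\<close>; a suitable \<open>f\<close> is a proper
  2-colouring of this graph, so the radii \<open>d x\<close> must be chosen such that there are no odd cycles.
  The centres are treated one after the other, keeping the components of the graph finite and free
  of odd cycles. Given a new centre \<open>a\<close>, let \<open>Q\<close> be its (finite) component in the graph built so
  far. If the new radius \<open>d\<close> is small enough, the \<open>d\<close>-balls around the points of \<open>Q\<close> are disjoint
  and each old reflection is, on each of them, either undefined or a map onto one of them. Hence a walk in the
  new graph starting at \<open>q + t\<close> with \<open>q \<in> Q\<close>, \<open>\<bar>t\<bar> < d\<close> only visits points \<open>q' + t\<close> after an even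
  and \<open>q' - t\<close> after an odd number of steps, with \<open>q' \<in> Q\<close>. Components thus remain finite, and an
  odd closed walk forces \<open>t = 0\<close>, in which case it already lived in the old graph.
\<close>

section \<open>Parity of walks and 2-colourings\<close>

text \<open>Only the parity of the length is recorded, \<open>True\<close> for odd, so that
  concatenation of walks becomes exclusive or, written \<open>\<noteq>\<close>.\<close>

inductive walk :: "('a \<Rightarrow> 'a \<Rightarrow> bool) \<Rightarrow> bool \<Rightarrow> 'a \<Rightarrow> 'a \<Rightarrow> bool" for E where
  refl: "walk E False x x"
| step: "walk E b x y \<Longrightarrow> E y z \<Longrightarrow> walk E (\<not> b) x z"

lemma walk_trans:
  assumes "walk E c y z" "walk E b x y"
  shows "walk E (b \<noteq> c) x z"
  using assms
proof (induction rule: walk.induct)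
  case (refl x)
  then show ?case by simp
next
  case (step c y z w)
  then have "walk E (\<not> (b \<noteq> c)) x w" by (blast intro: walk.step)
  then show ?case by (cases b; cases c) simp_all
qed

lemma walk_edge: "E x y \<Longrightarrow> walk E True x y"
  using walk.step[OF walk.refl, of E x y] by simp

lemma walk_sym:
  assumes "walk E b x y" "symp E"
  shows "walk E b y x"
  using assms
proof (induction rule: walk.induct)
  case (refl x)
  show ?case by (rule walk.refl)
next
  case (step b x y z)
  then have "walk E True z y" by (blast intro: walk_edge dest: sympD)
  with step have "walk E (True \<noteq> b) z x" by (blast intro: walk_trans)
  then show ?case by simp
qed

lemma walk_mono:
  assumes "walk E b x y" "\<And>x y. E x y \<Longrightarrow> F x y"
  shows "walk F b x y"
  using assms by (induction rule: walk.induct) (blast intro: walk.intros)+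

lemma walk_in_closed:
  assumes "walk E b x y" "x \<in> X" "\<And>x y. E x y \<Longrightarrow> x \<in> X \<Longrightarrow> y \<in> X"
  shows "y \<in> X"
  using assms by (induction rule: walk.induct) blast+

text \<open>Pulls a walk in an enlarged graph back to the old graph when it starts in a set that the
  enlarged graph cannot leave.\<close>

lemma walk_within_closed:
  assumes "walk E b x y" "x \<in> X" "\<And>x y. E x y \<Longrightarrow> x \<in> X \<Longrightarrow> y \<in> X \<and> F x y"
  shows "walk F b x y"
  using assms
proof (induction rule: walk.induct)
  case (refl x)
  show ?case by (rule walk.refl)
next
  case (step b x y z)
  then have "y \<in> X" using walk_in_closed[of E b x y X] by blast
  with step show ?case by (blast intro: walk.step)
qed

text \<open>Colour by the parity of walks from a root of the component: two walks of opposite parity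
  from the root to \<open>x\<close> would give an odd closed walk at \<open>x\<close>.\<close>

lemma two_colouring_if_no_odd_closed_walk:
  assumes "symp E" and odd: "\<And>x. x \<in> X \<Longrightarrow> \<not> walk E True x x"
  obtains f :: "'a \<Rightarrow> bool" where "\<And>x y. x \<in> X \<Longrightarrow> E x y \<Longrightarrow> f x \<noteq> f y"
proof -
  \<comment> \<open>The predicate under \<open>SOME\<close> depends only on the component of
    \<open>x\<close>, so adjacent vertices get the same root.\<close>
  define r where "r x = (SOME z. \<exists>b. walk E b z x)" for x
  have r: "\<exists>b. walk E b (r x) x" for x
    unfolding r_def by (rule someI[of _ x]) (blast intro: walk.refl)
  have "walk E True (r x) x \<noteq> walk E True (r y) y" if "x \<in> X" "E x y" for x y
  proof -
    have edge: "walk E b z x \<Longrightarrow> walk E (\<not> b) z y" "walk E b z y \<Longrightarrow> walk E (\<not> b) z x" for b z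
      using \<open>E x y\<close> \<open>symp E\<close> by (blast intro: walk.step dest: sympD)+
    then have "(\<exists>b. walk E b z x) \<longleftrightarrow> (\<exists>b. walk E b z y)" for z by blast
    then have eq: "r x = r y" unfolding r_def by simp
    have excl: "\<not> (walk E True (r x) x \<and> walk E False (r x) x)"
    proof
      assume "walk E True (r x) x \<and> walk E False (r x) x"
      then have w: "walk E True (r x) x" "walk E False (r x) x" by blast+
      have "walk E (False \<noteq> True) x x"
        by (rule walk_trans[OF w(1) walk_sym[OF w(2) \<open>symp E\<close>]])
      with odd \<open>x \<in> X\<close> show False by simp
    qed
    obtain b where "walk E b (r x) x" using r by blast
    with excl edge(1)[of b "r x"] edge(2)[of True "r x"] show ?thesis
      unfolding eq[symmetric] by (cases b) auto
  qed
  with that[of "\<lambda>x. walk E True (r x) x"] show ?thesis by blast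
qed

section \<open>Graphs of local reflections\<close>

text \<open>A pair \<open>(c, r)\<close> encodes the reflection in \<open>c\<close> restricted to
  the open ball of radius \<open>r\<close>. Its fixed point \<open>c\<close> must not give a loop,
  which would be an odd closed walk.\<close>

definition refl_edge :: "(real \<times> real) set \<Rightarrow> real \<Rightarrow> real \<Rightarrow> bool" where
  "refl_edge S x y \<longleftrightarrow> x \<noteq> y \<and> (\<exists>(c, r)\<in>S. y = 2 * c - x \<and> \<bar>x - c\<bar> < r)"

lemma symp_refl_edge: "symp (refl_edge S)"
  unfolding refl_edge_def by (rule sympI) (force simp: abs_minus_commute)

lemma refl_edge_mono: "refl_edge S x y \<Longrightarrow> S \<subseteq> T \<Longrightarrow> refl_edge T x y"
  unfolding refl_edge_def by blast

text \<open>No ball of the system has an endpoint in \<open>G\<close>, so that a point of \<open>G\<close> can be moved slightly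
  without changing the reflections defined on it.\<close>

definition tame :: "real set \<Rightarrow> (real \<times> real) set \<Rightarrow> bool" where
  "tame G S \<longleftrightarrow> finite S \<and>
     (\<forall>(c, r)\<in>S. (\<forall>x\<in>G. 2 * c - x \<in> G \<and> \<bar>x - c\<bar> \<noteq> r)) \<and>
     (\<forall>x\<in>G. finite {y. \<exists>b. walk (refl_edge S) b x y} \<and> \<not> walk (refl_edge S) True x x)"

lemma tame_empty: "tame G {}"
proof -
  have no: "\<not> refl_edge {} x y" for x y by (simp add: refl_edge_def)
  have "walk (refl_edge {}) b x y \<Longrightarrow> y = x \<and> \<not> b" for b x y
    by (induction rule: walk.induct) (simp_all add: no)
  then have "{y. \<exists>b. walk (refl_edge {}) b x y} \<subseteq> {x}" "\<not> walk (refl_edge {}) True x x" for x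
    by blast+
  then show ?thesis unfolding tame_def by (auto intro: finite_subset)
qed

lemma positive_lower_bound:
  fixes F :: "real set"
  assumes "finite F" "\<And>x. x \<in> F \<Longrightarrow> 0 < x"
  obtains e where "0 < e" "\<And>x. x \<in> F \<Longrightarrow> e \<le> x"
  using assms that[of "Min (insert 1 F)"] by auto

lemma tame_insert:
  assumes "tame G S" "countable G" "a \<in> G" and symm: "\<And>x. x \<in> G \<Longrightarrow> 2 * a - x \<in> G"
  obtains d where "0 < d" "tame G (insert (a, d) S)"
proof -
  have finS: "finite S"
    and closed: "\<And>c r x. (c, r) \<in> S \<Longrightarrow> x \<in> G \<Longrightarrow> 2 * c - x \<in> G"
    and bdry: "\<And>c r x. (c, r) \<in> S \<Longrightarrow> x \<in> G \<Longrightarrow> \<bar>x - c\<bar> \<noteq> r"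
    and finS_comp: "\<And>x. x \<in> G \<Longrightarrow> finite {y. \<exists>b. walk (refl_edge S) b x y}"
    and oddS: "\<And>x. x \<in> G \<Longrightarrow> \<not> walk (refl_edge S) True x x"
    using \<open>tame G S\<close> unfolding tame_def by blast+
  define Q where "Q = {q. \<exists>b. walk (refl_edge S) b a q}"
  have "finite Q" unfolding Q_def using finS_comp \<open>a \<in> G\<close> .
  have "a \<in> Q" unfolding Q_def by (blast intro: walk.refl)
  have Q_edge: "y \<in> Q" if "x \<in> Q" "refl_edge S x y" for x y
    using that unfolding Q_def by (blast intro: walk.step)
  have QG: "q \<in> G" if "q \<in> Q" for q
  proof -
    obtain b where "walk (refl_edge S) b a q" using \<open>q \<in> Q\<close> unfolding Q_def by blast
    then show ?thesis
      by (rule walk_in_closed) (use \<open>a \<in> G\<close> closed in \<open>auto simp: refl_edge_def\<close>)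
  qed
  \<comment> \<open>A radius below all these numbers makes the balls around \<open>Q\<close>
    disjoint and puts each of them entirely inside or outside every old ball.\<close>
  define F where "F = (\<lambda>(q, c, r). \<bar>\<bar>q - c\<bar> - r\<bar>) ` (Q \<times> S) \<union>
    (\<lambda>(q, q'). \<bar>q - q'\<bar> / 2) ` (Q \<times> Q - Id)"
  have "finite F" unfolding F_def using \<open>finite Q\<close> finS by blast
  moreover have "0 < x" if "x \<in> F" for x
    using that unfolding F_def by (auto dest: bdry[OF _ QG])
  ultimately obtain e where e: "0 < e" "\<And>x. x \<in> F \<Longrightarrow> e \<le> x"
    using positive_lower_bound[of F] by metis
  have e_bdry: "e \<le> \<bar>\<bar>q - c\<bar> - r\<bar>" if "q \<in> Q" "(c, r) \<in> S" for q c r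
    using that by (intro e) (force simp: F_def)
  have e_sep: "e \<le> \<bar>q - q'\<bar> / 2" if "q \<in> Q" "q' \<in> Q" "q \<noteq> q'" for q q'
    using that by (intro e) (force simp: F_def)
  have "countable ((\<lambda>x. \<bar>x - a\<bar>) ` G)" using \<open>countable G\<close> by simp
  \<comment> \<open>Avoiding the countably many distances from \<open>a\<close> to \<open>G\<close>
    keeps \<open>G\<close> off the boundary of the new ball.\<close>
  then obtain d where d: "0 < d" "d < e" "d \<notin> (\<lambda>x. \<bar>x - a\<bar>) ` G"
    using uncountable_open_interval[of 0 e] \<open>0 < e\<close> countable_subset[of "{0<..<e}"]
    by (metis greaterThanLessThan_iff subsetI)
  define T where "T = insert (a, d) S"
  define U where "U = {x. \<exists>q\<in>Q. \<bar>x - q\<bar> < d}"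
  have sep: "q = q'" if "q \<in> Q" "q' \<in> Q" "\<bar>x - q\<bar> < d" "\<bar>x - q'\<bar> < d" for q q' x
    using e_sep[of q q'] that d by argo
  have refl_ball: "2 * c - q \<in> Q"
    if "q \<in> Q" "\<bar>x - q\<bar> < d" "(c, r) \<in> T" "\<bar>x - c\<bar> < r" for q x c r
  proof (cases "(c, r) \<in> S")
    case True
    \<comment> \<open>No old boundary point lies within \<open>d\<close> of \<open>q\<close>, so
      \<open>q\<close> is in the old ball together with \<open>x\<close>.\<close>
    then have "\<bar>q - c\<bar> < r" using e_bdry[OF \<open>q \<in> Q\<close> True] that d by argo
    with True show ?thesis
      using Q_edge[OF \<open>q \<in> Q\<close>, of "2 * c - q"] \<open>q \<in> Q\<close>
      by (cases "q = c") (auto simp: refl_edge_def)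
  next
    case False
    then have "c = a" "r = d" using that by (auto simp: T_def)
    with that have "q = a" using sep \<open>a \<in> Q\<close> by blast
    with \<open>c = a\<close> \<open>a \<in> Q\<close> show ?thesis by simp
  qed
  \<comment> \<open>A reflection in \<open>c\<close> sends \<open>q' + s\<close> to
    \<open>(2 * c - q') - s\<close>: each step only flips the sign of the offset.\<close>
  have track: "\<exists>q'\<in>Q. y - q' = (if b then q - x else x - q)"
    if "walk (refl_edge T) b x y" "q \<in> Q" "\<bar>x - q\<bar> < d" for b x y q
    using that
  proof (induction rule: walk.induct)
    case (refl x)
    then show ?case by auto
  next
    case (step b x y z)
    then obtain q' where q': "q' \<in> Q" "y - q' = (if b then q - x else x - q)" by blast
    obtain c r where cr: "(c, r) \<in> T" "z = 2 * c - y" "\<bar>y - c\<bar> < r"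
      using step.hyps unfolding refl_edge_def by blast
    have "\<bar>y - q'\<bar> < d" using q' step.prems by (simp add: abs_minus_commute split: if_splits)
    then have "2 * c - q' \<in> Q" using refl_ball q' cr by blast
    moreover have "z - (2 * c - q') = (if \<not> b then q - x else x - q)" using q' cr by auto
    ultimately show ?case by blast
  qed
  have U_edge: "y \<in> U" if xy: "refl_edge T x y" and "x \<in> U" for x y
  proof -
    obtain q where q: "q \<in> Q" "\<bar>x - q\<bar> < d" using \<open>x \<in> U\<close> unfolding U_def by blast
    then obtain q' where "q' \<in> Q" "y - q' = q - x"
      using track[OF walk_edge[of "refl_edge T", OF xy]] by auto
    with q have "\<bar>y - q'\<bar> < d" by (simp add: abs_minus_commute)
    with \<open>q' \<in> Q\<close> show ?thesis unfolding U_def by blast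
  qed
  \<comment> \<open>The new ball lies in \<open>U\<close> and meets \<open>Q\<close> only in
    \<open>a\<close>, which the new reflection fixes, so it adds no edge at such an
    \<open>x\<close>.\<close>
  have old_edge: "refl_edge S x y" if xy: "refl_edge T x y" and x: "x \<notin> U \<or> x \<in> Q" for x y
  proof -
    obtain c r where cr: "(c, r) \<in> T" "y = 2 * c - x" "\<bar>x - c\<bar> < r" "x \<noteq> y"
      using xy unfolding refl_edge_def by blast
    have "\<not> (c = a \<and> r = d)"
    proof
      assume new: "c = a \<and> r = d"
      then have "x \<in> U" using cr \<open>a \<in> Q\<close> unfolding U_def by blast
      with x have "x = a" using sep[of x a x] \<open>a \<in> Q\<close> cr new d by auto
      with cr new show False by simp
    qed
    with cr show ?thesis unfolding refl_edge_def T_def by blast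
  qed
  have old_walk: "walk (refl_edge S) b x y"
    if w: "walk (refl_edge T) b x y" and x: "x \<notin> U \<or> x \<in> Q" for b x y
    using x
  proof
    assume "x \<notin> U"
    then have "x \<in> - U" by simp
    with w show ?thesis
      by (rule walk_within_closed) (use U_edge old_edge symp_refl_edge in \<open>blast dest: sympD\<close>)
  next
    assume "x \<in> Q"
    with w show ?thesis
      by (rule walk_within_closed) (use Q_edge old_edge in blast)
  qed
  have "finite {y. \<exists>b. walk (refl_edge T) b x y}" if "x \<in> G" for x
  proof (cases "x \<in> U")
    case True
    then obtain q where q: "q \<in> Q" "\<bar>x - q\<bar> < d" unfolding U_def by blast
    have "{y. \<exists>b. walk (refl_edge T) b x y} \<subseteq> (\<lambda>q'. q' + (q - x)) ` Q \<union> (\<lambda>q'. q' + (x - q)) ` Q"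
    proof clarify
      fix y b
      assume "walk (refl_edge T) b x y" and notin: "y \<notin> (\<lambda>q'. q' + (x - q)) ` Q"
      then obtain q' where q': "q' \<in> Q" "y - q' = (if b then q - x else x - q)"
        using track q by blast
      then have "y = q' + (if b then q - x else x - q)" by (simp add: algebra_simps)
      with q' notin show "y \<in> (\<lambda>q'. q' + (q - x)) ` Q" by (auto split: if_splits)
    qed
    then show ?thesis by (rule finite_subset) (use \<open>finite Q\<close> in simp)
  next
    case False
    then have "{y. \<exists>b. walk (refl_edge T) b x y} \<subseteq> {y. \<exists>b. walk (refl_edge S) b x y}"
      using old_walk by blast
    then show ?thesis by (rule finite_subset) (rule finS_comp[OF that])
  qed
  moreover have "\<not> walk (refl_edge T) True x x" if "x \<in> G" for x
  proof
    assume w: "walk (refl_edge T) True x x"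
    \<comment> \<open>An odd closed walk at \<open>q + t\<close> gives
      \<open>q + t = q' - t\<close>; separation yields \<open>q = q'\<close>, hence
      \<open>t = 0\<close>.\<close>
    have "x \<notin> U \<or> x \<in> Q"
    proof (rule disjCI)
      assume "\<not> x \<in> Q"
      show "x \<notin> U"
      proof
        assume "x \<in> U"
        then obtain q where q: "q \<in> Q" "\<bar>x - q\<bar> < d" unfolding U_def by blast
        then obtain q' where q': "q' \<in> Q" "x - q' = q - x" using track[OF w] by auto
        then have "q = q'" using sep[of q q' x] q by (simp add: abs_minus_commute)
        with q' have "x = q" by simp
        with q \<open>\<not> x \<in> Q\<close> show False by simp
      qed
    qed
    with w oddS that show False using old_walk by blast
  qed
  ultimately have "tame G T"
    unfolding tame_def T_def using finS closed bdry symm d by (auto dest: bdry)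
  with d that show ?thesis unfolding T_def by blast
qed

section \<open>A countable vertex set and the passage to all centres\<close>

lemma countable_reflection_closed_superset:
  fixes A :: "real set"
  assumes "countable A"
  obtains G where "countable G" "A \<subseteq> G" "\<And>a x. a \<in> A \<Longrightarrow> x \<in> G \<Longrightarrow> 2 * a - x \<in> G"
proof
  \<comment> \<open>The additive group generated by \<open>A\<close>, written as finite sums of
    elements and their negatives; it is countable because there are only countably many such
    lists.\<close>
  define G where "G = sum_list ` lists (A \<union> uminus ` A)"
  show "countable G" unfolding G_def using assms by simp
  show "A \<subseteq> G"
  proof
    fix a assume "a \<in> A"
    then have "[a] \<in> lists (A \<union> uminus ` A)" "a = sum_list [a]" by simp_all
    then show "a \<in> G" unfolding G_def by blast
  qed
  show "2 * a - x \<in> G" if "a \<in> A" "x \<in> G" for a x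
  proof -
    obtain xs where xs: "xs \<in> lists (A \<union> uminus ` A)" "x = sum_list xs"
      using \<open>x \<in> G\<close> unfolding G_def by blast
    have "a # a # map uminus xs \<in> lists (A \<union> uminus ` A)" using xs \<open>a \<in> A\<close> by fastforce
    moreover have "sum_list (map uminus xs) = - sum_list xs" by (induction xs) simp_all
    then have "2 * a - x = sum_list (a # a # map uminus xs)" using xs by simp
    ultimately show ?thesis unfolding G_def by blast
  qed
qed

theorem theorem1:
  fixes A :: "real set"
  assumes "countable A"
  shows "\<exists>f \<in> A \<rightarrow> {0, 1}. uniformly_antisymmetric_on A f"
proof (cases "A = {}")
  case True
  then show ?thesis by (auto simp: uniformly_antisymmetric_on_def)
next
  case False
  obtain G where G: "countable G" "A \<subseteq> G" "\<And>a x. a \<in> A \<Longrightarrow> x \<in> G \<Longrightarrow> 2 * a - x \<in> G"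
    using countable_reflection_closed_superset[OF assms] by blast
  define a where "a = from_nat_into A"
  have range_a: "range a = A"
    unfolding a_def using False assms by (rule range_from_nat_into)
  have extend: "\<exists>T. (tame G T \<and> (\<exists>d>0. (a n, d) \<in> T)) \<and> S \<subseteq> T" if tame: "tame G S" for S n
  proof -
    have "a n \<in> A" using range_a by blast
    then obtain d where "0 < d" "tame G (insert (a n, d) S)"
      using tame_insert[OF tame, of "a n"] G by blast
    then show ?thesis by blast
  qed
  \<comment> \<open>The union of all stages may have infinite components, so \<open>tame\<close> is
    only maintained at each single stage.\<close>
  have "\<exists>S. \<forall>n. (tame G (S n) \<and> (\<exists>d>0. (a n, d) \<in> S n)) \<and> S n \<subseteq> S (Suc n)"
  proof (rule dependent_nat_choice)
    show "\<exists>T. tame G T \<and> (\<exists>d>0. (a 0, d) \<in> T)" using extend[OF tame_empty] by blast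
  qed (use extend in simp)
  then obtain S where S: "\<And>n. tame G (S n) \<and> (\<exists>d>0. (a n, d) \<in> S n)" "\<And>n. S n \<subseteq> S (Suc n)"
    by metis
  define E where "E = refl_edge (\<Union>n. S n)"
  have mono: "S m \<subseteq> S n" if "m \<le> n" for m n
    using S(2) that by (rule lift_Suc_mono_le)
  have E_stage: "\<exists>n. refl_edge (S n) x y" if "E x y" for x y
    using that unfolding E_def refl_edge_def by blast
  \<comment> \<open>A walk uses finitely many edges, so an odd closed walk in the union would
    already occur at some stage.\<close>
  have walk_stage: "\<exists>n. walk (refl_edge (S n)) b x y" if "walk E b x y" for b x y
    using that
  proof (induction rule: walk.induct)
    case (refl x)
    show ?case by (blast intro: walk.refl)
  next
    case (step b x y z)
    then obtain m n where m: "walk (refl_edge (S m)) b x y" and n: "refl_edge (S n) y z"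
      using E_stage by blast
    have "walk (refl_edge (S (max m n))) b x y"
      using m by (rule walk_mono) (erule refl_edge_mono, simp add: mono)
    moreover have "refl_edge (S (max m n)) y z"
      using n by (rule refl_edge_mono) (simp add: mono)
    ultimately show ?case by (blast intro: walk.step)
  qed
  have "\<not> walk E True x x" if "x \<in> G" for x
    using walk_stage S(1) that unfolding tame_def by blast
  moreover have "symp E" unfolding E_def by (rule symp_refl_edge)
  ultimately obtain g :: "real \<Rightarrow> bool" where g: "\<And>x y. x \<in> G \<Longrightarrow> E x y \<Longrightarrow> g x \<noteq> g y"
    using two_colouring_if_no_odd_closed_walk[of E G] by metis
  define f :: "real \<Rightarrow> real" where "f x = of_bool (g x)" for x
  have "\<exists>d>0. \<forall>h. 0 < h \<and> h < d \<and> x - h \<in> A \<and> x + h \<in> A \<longrightarrow> \<bar>f (x + h) - f (x - h)\<bar> \<ge> d"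
    if "x \<in> A" for x
  proof -
    obtain n where "x = a n" using range_a \<open>x \<in> A\<close> by blast
    then obtain d where d: "0 < d" "(x, d) \<in> S n" using S(1) by blast
    \<comment> \<open>Distinct colours differ by exactly 1, and the radius is also the required
      lower bound, hence the cap at 1.\<close>
    have "\<bar>f (x + h) - f (x - h)\<bar> \<ge> min d 1" if h: "0 < h" "h < min d 1" "x + h \<in> A" for h
    proof -
      have "refl_edge (S n) (x + h) (x - h)"
        unfolding refl_edge_def using h d by (auto intro!: bexI[of _ "(x, d)"])
      then have "E (x + h) (x - h)" unfolding E_def by (rule refl_edge_mono) blast
      then have "g (x + h) \<noteq> g (x - h)" using g G(2) h by blast
      then show ?thesis by (auto simp: f_def)
    qed
    with d show ?thesis by (intro exI[of _ "min d 1"]) auto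
  qed
  then have "uniformly_antisymmetric_on A f" unfolding uniformly_antisymmetric_on_def by blast
  moreover have "f \<in> A \<rightarrow> {0, 1}" by (simp add: f_def)
  ultimately show ?thesis by blast
qed

end
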